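(* Let $d\ge2$. For every $A\in\mathcal{S}_{rc}^d$, $$\Phi(A)=rc(\mathbb{R}^d\setminus i(A)).$$ In particular, if $X\in\mathcal{S}_1^d$, then $\Phi(X)\in\mathcal{S}_1^d$ and $$\Phi(X)=\overline{\mathbb{R}^d\setminus i(X)}\quad\text{for every }X\in\mathcal{S}_1^d.$$
   Context: $\mathbb{S}^{d-1}$ is the unit sphere of $\mathbb{R}^d$. A star set is a non-empty $A\subseteq\mathbb{R}^d$ with $ta\in A$ for all $a\in A$, $0\le t\le 1$. Its radial function is $\rho_A:\mathbb{S}^{d-1}\to[0,\infty]$, $\rho_A(\theta)=\sup\{\lambda\ge 0:\lambda\theta\in A\}$. A star body is a star set $A$ that is radially closed: $\rho_A(\theta)\theta\in A$ whenever $\rho_A(\theta)<\infty$; it need not be closed or bounded, and it is determined by $\rho_A$. $\mathcal{S}_{rc}^d$ is the family of all star bodies in $\mathbb{R}^d$, and $\mathcal{S}_1^d$ the subfamily of those with continuous radial function $\rho_A:\mathbb{S}^{d-1}\to[0,\infty]$. The star duality $\Phi:\mathcal{S}_{rc}^d\to\mathcal{S}_{rc}^d$ sends $A$ to the star body with $\rho_{\Phi(A)}=1/\rho_A$, with the conventions $1/0=\infty$, $1/\infty=0$. $i:\mathbb{R}^d\setminus\{0\}\to\mathbb{R}^d\setminus\{0\}$, $i(x)=x/\|x\|^2$, is the spherical inversion, and $i(A)$ denotes the image of $A\setminus\{0\}$ under $i$. For $A\in\mathcal{S}_{rc}^d$ the set $\mathbb{R}^d\setminus i(A)$ is a star set.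 For a star set $S$, $rc(S)$ denotes its radial closure, i.e. the unique star body with radial function $\rho_S$. The bar denotes topological closure. *)

theory Defs
  imports "HOL-Analysis.Analysis"
begin

definition star_set :: "'a::euclidean_space set \<Rightarrow> bool" where
  "star_set A \<longleftrightarrow> A \<noteq> {} \<and> (\<forall>a\<in>A. \<forall>t. 0 \<le> t \<and> t \<le> 1 \<longrightarrow> t *\<^sub>R a \<in> A)"

text \<open>The extended half-line \<open>[0,\<infinity>]\<close> is rendered as \<^typ>\<open>ennreal\<close>, whose order topology is the
  usual one and whose division satisfies \<open>1 / 0 = \<infinity>\<close> and \<open>1 / \<infinity> = 0\<close>.
  Only the values at unit vectors are meaningful.\<close>

definition radial_function :: "'a::euclidean_space set \<Rightarrow> 'a \<Rightarrow> ennreal" where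
  "radial_function A \<theta> = Sup (ennreal ` {l. 0 \<le> l \<and> l *\<^sub>R \<theta> \<in> A})"

definition star_body :: "'a::euclidean_space set \<Rightarrow> bool" where
  "star_body A \<longleftrightarrow> star_set A \<and>
     (\<forall>\<theta>\<in>sphere 0 1. radial_function A \<theta> < \<infinity> \<longrightarrow> enn2real (radial_function A \<theta>) *\<^sub>R \<theta> \<in> A)"

definition star_bodies :: "'a::euclidean_space set set" where
  "star_bodies = {A. star_body A}"

definition continuous_star_bodies :: "'a::euclidean_space set set" where
  "continuous_star_bodies = {A \<in> star_bodies. continuous_on (sphere 0 1) (radial_function A)}"

text \<open>The definite description is justified by \<open>ex1_star_body_radial\<close> below.\<close>

definition star_body_of_radial :: "('a::euclidean_space \<Rightarrow> ennreal) \<Rightarrow> 'a set" where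
  "star_body_of_radial f =
     (THE B. star_body B \<and> (\<forall>\<theta>\<in>sphere 0 1. radial_function B \<theta> = f \<theta>))"

definition star_dual :: "'a::euclidean_space set \<Rightarrow> 'a set" where
  "star_dual A = star_body_of_radial (\<lambda>\<theta>. 1 / radial_function A \<theta>)"

definition radial_closure :: "'a::euclidean_space set \<Rightarrow> 'a set" where
  "radial_closure S = star_body_of_radial (radial_function S)"

definition spherical_inversion :: "'a::euclidean_space \<Rightarrow> 'a" where
  "spherical_inversion x = x /\<^sub>R (norm x)\<^sup>2"

definition inversion_image :: "'a::euclidean_space set \<Rightarrow> 'a set" where
  "inversion_image A = spherical_inversion ` (A - {0})"

lemma star_set_zero: "star_set A \<Longrightarrow> 0 \<in> A"
  unfolding star_set_def by (metis all_not_in_conv order_refl scaleR_zero_left zero_le_one)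

lemma star_set_ray_mono:
  assumes "star_set A" "l *\<^sub>R \<theta> \<in> A" "0 \<le> m" "m \<le> l"
  shows "m *\<^sub>R \<theta> \<in> A"
proof (cases "l = 0")
  case True
  then show ?thesis using assms by simp
next
  case False
  then have "0 \<le> m / l" "m / l \<le> 1" using assms by (auto simp: divide_le_eq_1)
  then have "(m / l) *\<^sub>R (l *\<^sub>R \<theta>) \<in> A"
    using assms(1,2) unfolding star_set_def by blast
  then show ?thesis using False by simp
qed

lemma star_body_ray_iff:
  assumes A: "star_body A" and \<theta>: "norm \<theta> = 1" and l: "0 \<le> l"
  shows "l *\<^sub>R \<theta> \<in> A \<longleftrightarrow> ennreal l \<le> radial_function A \<theta>"
proof
  assume "l *\<^sub>R \<theta> \<in> A"
  then show "ennreal l \<le> radial_function A \<theta>"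
    unfolding radial_function_def using l by (intro Sup_upper) auto
next
  assume le: "ennreal l \<le> radial_function A \<theta>"
  have S: "star_set A" using A by (simp add: star_body_def)
  show "l *\<^sub>R \<theta> \<in> A"
  proof (cases "ennreal l < radial_function A \<theta>")
    case True
    then obtain m where "0 \<le> m" "m *\<^sub>R \<theta> \<in> A" "ennreal l < ennreal m"
      unfolding radial_function_def less_Sup_iff by auto
    then show ?thesis
      using star_set_ray_mono[OF S] l by (metis ennreal_less_iff less_imp_le)
  next
    case False
    then have eq: "radial_function A \<theta> = ennreal l" using le by simp
    moreover have "radial_function A \<theta> < \<infinity>" "\<theta> \<in> sphere 0 1" using eq \<theta> by simp_all
    ultimately have "enn2real (radial_function A \<theta>) *\<^sub>R \<theta> \<in> A"
      using A \<open>\<theta> \<in> sphere 0 1\<close> unfolding star_body_def by blast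
    then show ?thesis using eq l by simp
  qed
qed

lemma star_body_eqI:
  assumes A: "star_body A" and B: "star_body B"
    and eq: "\<forall>\<theta>\<in>sphere 0 1. radial_function A \<theta> = radial_function B \<theta>"
  shows "A = B"
proof (rule set_eqI)
  fix x
  show "x \<in> A \<longleftrightarrow> x \<in> B"
  proof (cases "x = 0")
    case True
    then show ?thesis using A B by (simp add: star_body_def star_set_zero)
  next
    case False
    define \<theta> where "\<theta> = x /\<^sub>R norm x"
    have \<theta>: "norm \<theta> = 1" "x = norm x *\<^sub>R \<theta>" using False by (simp_all add: \<theta>_def)
    have "norm x *\<^sub>R \<theta> \<in> A \<longleftrightarrow> norm x *\<^sub>R \<theta> \<in> B"
      using eq \<theta>(1) by (simp add: star_body_ray_iff[OF A] star_body_ray_iff[OF B])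
    then show ?thesis using \<theta>(2) by simp
  qed
qed

lemma Sup_ennreal_le: "Sup (ennreal ` {l. 0 \<le> l \<and> ennreal l \<le> c}) = c"
proof (rule antisym)
  show "Sup (ennreal ` {l. 0 \<le> l \<and> ennreal l \<le> c}) \<le> c"
    by (rule Sup_least) auto
  show "c \<le> Sup (ennreal ` {l. 0 \<le> l \<and> ennreal l \<le> c})"
  proof (rule dense_le)
    fix y assume y: "y < c"
    then have "y < top" using top.not_eq_extremum by fastforce
    then have "ennreal (enn2real y) = y" by simp
    then have "y \<in> ennreal ` {l. 0 \<le> l \<and> ennreal l \<le> c}"
      using y by (metis (mono_tags, lifting) enn2real_nonneg image_eqI less_imp_le mem_Collect_eq)
    then show "y \<le> Sup (ennreal ` {l. 0 \<le> l \<and> ennreal l \<le> c})" by (rule Sup_upper)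
  qed
qed

lemma ex1_star_body_radial:
  fixes f :: "'a::euclidean_space \<Rightarrow> ennreal"
  shows "\<exists>!B. star_body B \<and> (\<forall>\<theta>\<in>sphere 0 1. radial_function B \<theta> = f \<theta>)"
proof -
  define B where "B = {x::'a. x = 0 \<or> ennreal (norm x) \<le> f (x /\<^sub>R norm x)}"
  have ray: "l *\<^sub>R \<theta> \<in> B \<longleftrightarrow> ennreal l \<le> f \<theta>" if "norm \<theta> = 1" "0 \<le> l" for l \<theta>
    using that by (cases "l = 0") (auto simp: B_def)
  have rad: "radial_function B \<theta> = f \<theta>" if "norm \<theta> = 1" for \<theta>
  proof -
    have "{l. 0 \<le> l \<and> l *\<^sub>R \<theta> \<in> B} = {l. 0 \<le> l \<and> ennreal l \<le> f \<theta>}"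
      using ray[OF that] by auto
    then show ?thesis by (simp add: radial_function_def Sup_ennreal_le)
  qed
  have "t *\<^sub>R a \<in> B" if a: "a \<in> B" and t: "0 \<le> t" "t \<le> 1" for a t
  proof (cases "a = 0 \<or> t = 0")
    case True
    then show ?thesis by (auto simp: B_def)
  next
    case False
    have "t * norm a \<le> norm a" using t by (simp add: mult_left_le_one_le)
    then have "ennreal (t * norm a) \<le> ennreal (norm a)" by (rule ennreal_leI)
    moreover have "(t *\<^sub>R a) /\<^sub>R norm (t *\<^sub>R a) = a /\<^sub>R norm a"
      using False t by simp
    ultimately show ?thesis
      using a t False unfolding B_def mem_Collect_eq by (metis abs_of_nonneg norm_scaleR order_trans)
  qed
  then have "star_set B" unfolding star_set_def by (auto simp: B_def)
  moreover have "enn2real (radial_function B \<theta>) *\<^sub>R \<theta> \<in> B"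
    if "norm \<theta> = 1" "radial_function B \<theta> < \<infinity>" for \<theta>
    using that by (simp add: ray rad)
  ultimately have "star_body B" by (simp add: star_body_def)
  moreover have "\<forall>\<theta>\<in>sphere 0 1. radial_function B \<theta> = f \<theta>" using rad by simp
  ultimately show ?thesis using star_body_eqI by metis
qed

lemma star_body_of_radial:
  "star_body (star_body_of_radial f)"
  "\<theta> \<in> sphere 0 1 \<Longrightarrow> radial_function (star_body_of_radial f) \<theta> = f \<theta>"
  using theI'[OF ex1_star_body_radial[of f]] unfolding star_body_of_radial_def by blast+

lemma spherical_inversion_involution: "spherical_inversion (spherical_inversion x) = x"
  by (cases "x = 0") (simp_all add: spherical_inversion_def power2_eq_square field_simps)

lemma spherical_inversion_eq_0_iff: "spherical_inversion x = 0 \<longleftrightarrow> x = 0"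
  by (auto simp: spherical_inversion_def)

lemma mem_inversion_image_iff:
  "x \<in> inversion_image A \<longleftrightarrow> x \<noteq> 0 \<and> spherical_inversion x \<in> A"
  unfolding inversion_image_def
  by (auto simp: spherical_inversion_involution spherical_inversion_eq_0_iff image_iff)
     (metis DiffI singletonD spherical_inversion_eq_0_iff spherical_inversion_involution)

lemma star_set_compl_inversion_image:
  assumes A: "star_set A"
  shows "star_set (UNIV - inversion_image A)"
proof -
  have "t *\<^sub>R a \<notin> inversion_image A" if a: "a \<notin> inversion_image A" and t: "0 \<le> t" "t \<le> 1" for a t
  proof
    assume ta: "t *\<^sub>R a \<in> inversion_image A"
    then have nz: "t \<noteq> 0" "a \<noteq> 0" and "spherical_inversion (t *\<^sub>R a) \<in> A"
      by (auto simp: mem_inversion_image_iff)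
    then have "t *\<^sub>R spherical_inversion (t *\<^sub>R a) \<in> A"
      using A t by (simp add: star_set_def)
    moreover have "t *\<^sub>R spherical_inversion (t *\<^sub>R a) = spherical_inversion a"
      using nz by (simp add: spherical_inversion_def power2_eq_square field_simps)
    ultimately show False using a nz by (simp add: mem_inversion_image_iff)
  qed
  moreover have "0 \<notin> inversion_image A" by (simp add: mem_inversion_image_iff)
  ultimately show ?thesis unfolding star_set_def by auto
qed

end

(* The inversion maps the ray point l\<theta> to (1/l)\<theta>, so the ray of the complement of i(A) in
   direction \<theta> is {0} together with all l\<theta> such that l < 1/\<rho>(\<theta>), where \<rho> is the radial
   function of A. Hence the complement and the dual differ at most by the endpoints of the rays,
   and these are limits of points of the ray. Conversely, a star body with continuous radial
   function is closed. *)
theory Submission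
  imports Defs
begin

text \<open>The extreme values fit too: for \<open>c = 0\<close> both sides hold, for
  \<open>c = top\<close> both fail, since \<open>l\<close> and \<open>1 / l\<close> are positive and
  finite.\<close>

lemma less_inverse_ennreal_iff:
  assumes "0 < l"
  shows "ennreal l < 1 / c \<longleftrightarrow> c < ennreal (1 / l)"
proof (cases c)
  case (real r)
  show ?thesis
  proof (cases "r = 0")
    case True
    then show ?thesis using real assms by simp
  next
    case False
    then have "0 < r" using real by simp
    then have "1 / c = ennreal (1 / r)"
      using real divide_ennreal[of 1 r] by simp
    then show ?thesis
      using real \<open>0 < r\<close> assms by (simp add: ennreal_less_iff field_simps)
  qed
next
  case top
  then show ?thesis by simp
qed

text \<open>The inequality is strict because the radially closed \<open>A\<close> contains the
  endpoints of its rays, so their inverses are removed. The origin is kept out by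
  \<open>0 < l\<close>: it always lies in the complement, even where the right-hand side is
  \<open>0 < 0\<close>.\<close>

lemma mem_compl_inversion_image_ray_iff:
  assumes A: "star_body A" and \<theta>: "norm \<theta> = 1" and l: "0 < l"
  shows "l *\<^sub>R \<theta> \<in> UNIV - inversion_image A \<longleftrightarrow> ennreal l < 1 / radial_function A \<theta>"
proof -
  have "\<theta> \<noteq> 0" using \<theta> by auto
  have "spherical_inversion (l *\<^sub>R \<theta>) = (1 / l) *\<^sub>R \<theta>"
    using \<theta> l by (simp add: spherical_inversion_def power2_eq_square field_simps)
  then have "l *\<^sub>R \<theta> \<in> UNIV - inversion_image A \<longleftrightarrow> \<not> ennreal (1 / l) \<le> radial_function A \<theta>"
    using l \<open>\<theta> \<noteq> 0\<close> star_body_ray_iff[OF A \<theta>, of "1 / l"] by (simp add: mem_inversion_image_iff)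
  then show ?thesis using less_inverse_ennreal_iff[OF l] by (simp add: not_le)
qed

text \<open>Losing the endpoint of a ray does not change the supremum along it.\<close>

lemma radial_function_compl_inversion_image:
  assumes A: "star_body A" and \<theta>: "norm \<theta> = 1"
  shows "radial_function (UNIV - inversion_image A) \<theta> = 1 / radial_function A \<theta>"
    (is "?L = ?c")
proof (rule antisym)
  have zero: "0 \<in> UNIV - inversion_image A"
    by (simp add: mem_inversion_image_iff)
  show "?L \<le> ?c"
    unfolding radial_function_def[of "UNIV - inversion_image A"]
  proof (rule SUP_least)
    fix l
    assume "l \<in> {l. 0 \<le> l \<and> l *\<^sub>R \<theta> \<in> UNIV - inversion_image A}"
    then show "ennreal l \<le> ?c"
      using mem_compl_inversion_image_ray_iff[OF A \<theta>, of l] by (cases "l = 0") auto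
  qed
  show "?c \<le> ?L"
  \<comment> \<open>Any \<open>y\<close> strictly below the bound is finite, hence a real parameter
    \<open>l\<close> whose ray point lies in the complement; this also covers
    \<open>?c = top\<close>.\<close>
  proof (rule dense_le)
    fix y assume y: "y < ?c"
    then obtain l where l: "0 \<le> l" "y = ennreal l"
      by (cases y) auto
    have "l *\<^sub>R \<theta> \<in> UNIV - inversion_image A"
      using mem_compl_inversion_image_ray_iff[OF A \<theta>, of l] y l zero by (cases "l = 0") auto
    then show "y \<le> ?L"
      unfolding radial_function_def using l by (intro Sup_upper) auto
  qed
qed

lemma star_body_of_radial_cong:
  assumes "\<And>\<theta>. norm \<theta> = 1 \<Longrightarrow> f \<theta> = g \<theta>"
  shows "star_body_of_radial f = star_body_of_radial g"
  using assms by (intro star_body_eqI) (simp_all add: star_body_of_radial)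

lemma star_body_zero: "star_body A \<Longrightarrow> 0 \<in> A"
  by (simp add: star_body_def star_set_zero)

lemma star_body_star_dual: "star_body (star_dual A)"
  by (simp add: star_dual_def star_body_of_radial)

lemma radial_function_star_dual:
  "norm \<theta> = 1 \<Longrightarrow> radial_function (star_dual A) \<theta> = 1 / radial_function A \<theta>"
  by (simp add: star_dual_def star_body_of_radial)

lemma star_dual_eq_radial_closure:
  assumes "star_body A"
  shows "star_dual A = radial_closure (UNIV - inversion_image A)"
  unfolding star_dual_def radial_closure_def
  using assms by (intro star_body_of_radial_cong) (simp add: radial_function_compl_inversion_image)

lemma star_dual_continuous:
  assumes "X \<in> continuous_star_bodies"
  shows "star_dual X \<in> continuous_star_bodies"
proof -
  \<comment> \<open>Inversion is continuous on all of \<open>ennreal\<close>, including at 0 and at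
    infinity.\<close>
  have "continuous_on (sphere 0 1) (\<lambda>\<theta>. inverse (radial_function X \<theta>))"
    using assms by (intro continuous_on_inverse_ennreal) (simp add: continuous_star_bodies_def)
  then have "continuous_on (sphere 0 1) (radial_function (star_dual X))"
    by (rule continuous_on_eq) (simp add: radial_function_star_dual divide_ennreal_def)
  then show ?thesis
    by (simp add: continuous_star_bodies_def star_bodies_def star_body_star_dual)
qed

lemma star_body_mem_iff:
  assumes "star_body A" "x \<noteq> 0"
  shows "x \<in> A \<longleftrightarrow> ennreal (norm x) \<le> radial_function A (x /\<^sub>R norm x)"
  using star_body_ray_iff[OF assms(1), of "x /\<^sub>R norm x" "norm x"] assms(2) by simp

text \<open>Off the origin, the complement of \<open>A\<close> is given by a strict inequality
  between two continuous functions. The origin, where the direction is undefined, belongs to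
  \<open>A\<close>.\<close>

lemma closed_continuous_star_body:
  fixes A :: "'a::euclidean_space set"
  assumes "A \<in> continuous_star_bodies"
  shows "closed A"
proof -
  have A: "star_body A" and cont: "continuous_on (sphere 0 1) (radial_function A)"
    using assms by (auto simp: continuous_star_bodies_def star_bodies_def)
  \<comment> \<open>The extension of the radial function that is constant along open rays.\<close>
  define r where "r x = radial_function A (x /\<^sub>R norm x)" for x
  have "continuous_on (- {0}) r"
    unfolding r_def
    by (rule continuous_on_compose2[OF cont]) (auto intro!: continuous_intros simp: field_simps split: if_splits)
  then have isCont: "isCont r x" if "x \<noteq> 0" for x
    using that continuous_on_eq_continuous_at[of "- {0::'a}"] by auto
  have "open (- A)"
    unfolding open_subopen[of "- A"]
  proof (intro ballI)
    fix x assume x: "x \<in> - A"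
    have "x \<noteq> 0" using x star_body_zero[OF A] by auto
    then have "r x < ennreal (norm x)"
      using x star_body_mem_iff[OF A] by (auto simp: r_def)
    \<comment> \<open>A fixed separating value splits the comparison into two conditions, each
      stable near \<open>x\<close>.\<close>
    then obtain m where m: "r x < m" "m < ennreal (norm x)"
      using dense by blast
    have "(r \<longlongrightarrow> r x) (nhds x)"
      using isCont[OF \<open>x \<noteq> 0\<close>] by (simp add: isCont_def tendsto_at_iff_tendsto_nhds)
    moreover have "((\<lambda>y. ennreal (norm y)) \<longlongrightarrow> ennreal (norm x)) (nhds x)"
      by (intro tendsto_intros filterlim_ident)
    ultimately have "\<forall>\<^sub>F y in nhds x. r y < m \<and> m < ennreal (norm y) \<and> y \<noteq> 0"
      using m \<open>x \<noteq> 0\<close> by (intro eventually_conj order_tendstoD t1_space_nhds)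
    then obtain T where T: "open T" "x \<in> T" "\<forall>y\<in>T. r y < m \<and> m < ennreal (norm y) \<and> y \<noteq> 0"
      unfolding eventually_nhds by blast
    have "T \<subseteq> - A"
    proof
      fix y assume "y \<in> T"
      then have "y \<noteq> 0" "r y < ennreal (norm y)" using T(3) order.strict_trans by blast+
      then show "y \<in> - A" using star_body_mem_iff[OF A] by (auto simp: r_def)
    qed
    then show "\<exists>T. open T \<and> x \<in> T \<and> T \<subseteq> - A" using T by blast
  qed
  then show ?thesis by (simp add: closed_def)
qed

text \<open>A nonzero point of the dual is the limit of the shorter points on its ray, which satisfy
  the strict inequality.\<close>

lemma star_dual_subset_closure:
  fixes A :: "'a::euclidean_space set"
  assumes A: "star_body A"
  shows "star_dual A \<subseteq> closure (UNIV - inversion_image A)"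
proof
  fix x assume x: "x \<in> star_dual A"
  show "x \<in> closure (UNIV - inversion_image A)"
  proof (cases "x = 0")
    case True
    then have "x \<in> UNIV - inversion_image A" by (simp add: mem_inversion_image_iff)
    then show ?thesis using closure_subset by blast
  next
    case False
    define \<theta> where "\<theta> = x /\<^sub>R norm x"
    have \<theta>: "norm \<theta> = 1" "x = norm x *\<^sub>R \<theta>" using False by (simp_all add: \<theta>_def)
    have le: "ennreal (norm x) \<le> 1 / radial_function A \<theta>"
      using x \<theta> star_body_ray_iff[OF star_body_star_dual[of A] \<theta>(1), of "norm x"]
      by (simp add: radial_function_star_dual)
    have lim: "((\<lambda>l. l *\<^sub>R \<theta>) \<longlongrightarrow> norm x *\<^sub>R \<theta>) (at_left (norm x))"
      by (intro tendsto_intros)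
    have "\<forall>\<^sub>F l in at_left (norm x). l *\<^sub>R \<theta> \<in> UNIV - inversion_image A"
    proof -
      have "\<forall>\<^sub>F l in at_left (norm x). l \<in> {0<..<norm x}"
        using False by (intro eventually_at_left_real) simp
      then show ?thesis
      proof eventually_elim
        case (elim l)
        then have "ennreal l < ennreal (norm x)" by (simp add: ennreal_less_iff)
        then show ?case
          using mem_compl_inversion_image_ray_iff[OF A \<theta>(1), of l] elim le by auto
      qed
    qed
    then have "\<forall>\<^sub>F l in at_left (norm x). l *\<^sub>R \<theta> \<in> closure (UNIV - inversion_image A)"
      by (rule eventually_mono) (rule subsetD[OF closure_subset])
    then have "norm x *\<^sub>R \<theta> \<in> closure (UNIV - inversion_image A)"
      by (rule Lim_in_closed_set[OF closed_closure _ _ lim]) simp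
    then show ?thesis using \<theta>(2) by simp
  qed
qed

lemma compl_inversion_image_subset_star_dual:
  assumes A: "star_body A"
  shows "UNIV - inversion_image A \<subseteq> star_dual A"
proof
  fix x assume x: "x \<in> UNIV - inversion_image A"
  show "x \<in> star_dual A"
  proof (cases "x = 0")
    case True
    then show ?thesis by (simp add: star_body_zero star_body_star_dual)
  next
    case False
    then show ?thesis
      using x mem_compl_inversion_image_ray_iff[OF A, of "x /\<^sub>R norm x" "norm x"]
      by (simp add: star_body_mem_iff[OF star_body_star_dual] radial_function_star_dual)
  qed
qed

lemma star_dual_eq_closure:
  assumes "X \<in> continuous_star_bodies"
  shows "star_dual X = closure (UNIV - inversion_image X)"
proof
  have X: "star_body X"
    using assms by (simp add: continuous_star_bodies_def star_bodies_def)
  show "star_dual X \<subseteq> closure (UNIV - inversion_image X)"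
    by (rule star_dual_subset_closure[OF X])
  show "closure (UNIV - inversion_image X) \<subseteq> star_dual X"
    \<comment> \<open>The dual contains the complement and is closed, since its radial function is
      again continuous.\<close>
    by (intro closure_minimal compl_inversion_image_subset_star_dual X
        closed_continuous_star_body star_dual_continuous assms)
qed

theorem proposition5p1:
  assumes "CARD('n::finite) \<ge> 2"
  shows "(\<forall>A \<in> (star_bodies :: (real ^ 'n) set set).
            star_dual A = radial_closure (UNIV - inversion_image A))
       \<and> (\<forall>X \<in> (continuous_star_bodies :: (real ^ 'n) set set).
            star_dual X \<in> continuous_star_bodies
          \<and> star_dual X = closure (UNIV - inversion_image X))"
  by (simp add: star_bodies_def star_dual_eq_radial_closure star_dual_continuous
      flip: star_dual_eq_closure)

end
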